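(* For any threshold $b>0$ and any weights $\rho_i\in(0,1)$, $1\le i\le L-1$, the WD-CuSum stopping time $\widetilde\tau(b)$ satisfies $$\mathbb{E}_\infty[\widetilde\tau(b)]\ \ge\ \tfrac12 e^{b}.$$
   Context: Model. Let $L\ge 1$ be a known integer and $f_0,f_1,\dots,f_L$ known probability densities with respect to a common measure. For each $1\le i\le L$ the Kullback-Leibler divergence $I_i=\int f_i\log\frac{f_i}{f_0}$ is assumed positive and finite. Independent random variables $X_1,X_2,\dots$ are observed sequentially. Under $\mathbb{P}_\infty$ (expectation $\mathbb{E}_\infty$) there is no change: all $X_k$ are i.i.d. with density $f_0$. WD-CuSum algorithm. Given $\rho_1,\dots,\rho_{L-1}\in(0,1)$, put $\rho_L=0$ and $v_{L+1}=\infty$. The (positive part of the) WD-CuSum statistic is $$(\widetilde W[k])^+=\max_{1\le v_1\le v_2\le\cdots\le v_L\le k+1}\log\left(\frac{\prod_{i=1}^{L}B_i}{\prod_{j=v_1}^{k}f_0(X_j)}\right),\qquad B_i=\left(\prod_{j=v_i}^{\min\{v_{i+1}-1,k\}}f_i(X_j)(1-\rho_i)\right)\rho_i^{\mathbf 1\{k\ge v_{i+1}\}},$$ with empty products equal to $1$ and $0^0=1$. (This is the weighted generalized likelihood ratio statistic corresponding to the prior $g(\boldsymbol d)=\prod_{i=1}^{L-1}\rho_i(1-\rho_i)^{d_i}$ on the vector of transient durations.) The WD-CuSum stopping time with threshold $b>0$ is $\widetilde\tau(b)=\inf\{k\ge1:\widetilde W[k]\ge b\}$; since $b>0$, $\widetilde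 W[k]$ may be replaced by $(\widetilde W[k])^+$. *)

theory Defs
  imports "HOL-Probability.Probability"
begin

definition prob_density :: "'a measure \<Rightarrow> ('a \<Rightarrow> real) \<Rightarrow> bool" where
  "prob_density \<mu> p \<longleftrightarrow>
     p \<in> borel_measurable \<mu> \<and> (\<forall>x\<in>space \<mu>. 0 \<le> p x) \<and> (\<integral>\<^sup>+ x. ennreal (p x) \<partial>\<mu>) = 1"

(* Kullback-Leibler divergence as an extended real. For probability densities the negative
   part of p * log (p / q) is always integrable, so the integral is infinite exactly when p does
   not vanish almost everywhere on {q = 0} or when the integrand below is not integrable.
   The library's KL_divergence is real-valued and cannot express finiteness. *)
definition KL_div :: "'a measure \<Rightarrow> ('a \<Rightarrow> real) \<Rightarrow> ('a \<Rightarrow> real) \<Rightarrow> ereal" where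
  "KL_div \<mu> p q =
     (if (AE x in \<mu>. q x = 0 \<longrightarrow> p x = 0) \<and> integrable \<mu> (\<lambda>x. p x * ln (p x / q x))
      then ereal (\<integral>x. p x * ln (p x / q x) \<partial>\<mu>) else \<infinity>)"

lemma (in sigma_finite_measure) KL_div_eq_KL_divergence:
  assumes "prob_density M p" "prob_density M q" "KL_div M p q < \<infinity>"
  shows "KL_div M p q = ereal (KL_divergence (exp 1) (density M q) (density M p))"
proof -
  have ac: "AE x in M. q x = 0 \<longrightarrow> p x = 0"
    using assms(3) by (auto simp: KL_div_def split: if_splits)
  have "KL_divergence (exp 1) (density M q) (density M p) = (\<integral>x. p x * log (exp 1) (p x / q x) \<partial>M)"
    using assms(1,2) by (intro KL_density_density ac) (auto simp: prob_density_def intro!: AE_I2)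
  then show ?thesis
    using assms(3) by (auto simp: KL_div_def log_def split: if_splits)
qed

(* Unlike ln on the reals, log 0 is minus infinity. *)
definition ext_ln :: "real \<Rightarrow> ereal" where
  "ext_ln r = (if r \<le> 0 then -\<infinity> else ereal (ln r))"

definition change_points :: "nat \<Rightarrow> nat \<Rightarrow> (nat \<Rightarrow> nat) set" where
  "change_points L k =
     {v \<in> {1..L} \<rightarrow>\<^sub>E {1..k + 1}. \<forall>i\<in>{1..<L}. v i \<le> v (i + 1)}"

definition next_change :: "nat \<Rightarrow> (nat \<Rightarrow> nat) \<Rightarrow> nat \<Rightarrow> enat" where
  "next_change L v i = (if i < L then enat (v (i + 1)) else \<infinity>)"

(* The index set below is the integer interval from v i to min (v (i+1) - 1) k. *)
definition wd_factor ::
  "nat \<Rightarrow> (nat \<Rightarrow> 'a \<Rightarrow> real) \<Rightarrow> (nat \<Rightarrow> real) \<Rightarrow> (nat \<Rightarrow> 'a) \<Rightarrow> nat \<Rightarrow> (nat \<Rightarrow> nat) \<Rightarrow> nat \<Rightarrow> real" where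
  "wd_factor L f \<rho> x k v i =
     (\<Prod>j | v i \<le> j \<and> enat j < next_change L v i \<and> j \<le> k. f i (x j) * (1 - \<rho> i))
       * \<rho> i ^ (if next_change L v i \<le> enat k then 1 else 0)"

(* The positive part of the statistic: v 1 = k + 1 is allowed and contributes log 1 = 0.
   A vanishing denominator, read as 0 by real division, only occurs with probability 0
   when the observations have density f 0. *)
definition wd_cusum_plus ::
  "nat \<Rightarrow> (nat \<Rightarrow> 'a \<Rightarrow> real) \<Rightarrow> (nat \<Rightarrow> real) \<Rightarrow> (nat \<Rightarrow> 'a) \<Rightarrow> nat \<Rightarrow> ereal" where
  "wd_cusum_plus L f \<rho> x k =
     Max ((\<lambda>v. ext_ln ((\<Prod>i=1..L. wd_factor L f \<rho> x k v i) / (\<Prod>j=v 1..k. f 0 (x j))))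
          ` change_points L k)"

(* The infimum of the empty set is infinity. *)
definition wd_cusum_time ::
  "nat \<Rightarrow> (nat \<Rightarrow> 'a \<Rightarrow> real) \<Rightarrow> (nat \<Rightarrow> real) \<Rightarrow> (nat \<Rightarrow> 'a) \<Rightarrow> real \<Rightarrow> enat" where
  "wd_cusum_time L f \<rho> x b = Inf {enat k | k. 1 \<le> k \<and> ereal b \<le> wd_cusum_plus L f \<rho> x k}"

end

theory Submission
  imports Defs
begin

text \<open>
  The weights are the probabilities of a prior in which the change happens at time \<open>v\<^sub>1\<close> and
  stage \<open>i\<close> lasts a geometric time with parameter \<open>\<rho>\<^sub>i\<close>, truncated at time \<open>k\<close>. Summing instead of
  maximizing over the change points with \<open>v\<^sub>1 \<le> k\<close> therefore gives a Shiryaev-Roberts type statistic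
  \<open>R\<^sub>k\<close> that dominates the exponential of the WD-CuSum statistic as soon as the latter is positive, and
  \<open>R\<^sub>k - k\<close> is a supermartingale under the no-change measure. With \<open>G\<^sub>n\<close> the event that \<open>R\<close> has stayed
  below \<open>e\<^sup>b\<close> up to time \<open>n\<close>, optional stopping reads
  \<open>e\<^sup>b (1 - P G\<^sub>n) \<le> P G\<^sub>0 + \<dots> + P G\<^sub>n\<^sub>-\<^sub>1 \<le> E \<tau>\<close>, and \<open>P G\<^sub>n \<le> 1/2\<close> for \<open>n \<ge> 2 E \<tau>\<close>
  because \<open>n P G\<^sub>n \<le> E \<tau>\<close>.
\<close>

text \<open>
  Here \<open>a i\<close> is the total weight of the paths in stage \<open>i\<close> at the current observation; the result is
  the weight just before the next observation, after any number of stages (possibly of length \<open>0\<close>)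
  has been passed. Stage \<open>0\<close> is a source that starts one new path at each time, hence the factor
  \<open>1\<close> in place of \<open>\<rho> 0\<close>, which the model leaves unspecified.
\<close>

primrec entry_weight :: "(nat \<Rightarrow> real) \<Rightarrow> (nat \<Rightarrow> real) \<Rightarrow> nat \<Rightarrow> real" where
  "entry_weight \<rho> a 0 = 1"
| "entry_weight \<rho> a (Suc i) = a (Suc i) + (if i = 0 then 1 else \<rho> i) * entry_weight \<rho> a i"

primrec state_weight ::
  "(nat \<Rightarrow> real) \<Rightarrow> (nat \<Rightarrow> 'a \<Rightarrow> real) \<Rightarrow> (nat \<Rightarrow> 'a) \<Rightarrow> nat \<Rightarrow> nat \<Rightarrow> real" where
  "state_weight \<rho> g x 0 = (\<lambda>i. 0)"
| "state_weight \<rho> g x (Suc n) =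
     (\<lambda>i. entry_weight \<rho> (state_weight \<rho> g x n) i * ((1 - \<rho> i) * g i (x (Suc n))))"

section \<open>Signs, mass balance and measurability of the stage weights\<close>

lemma entry_weight_nonneg:
  assumes "\<And>i. 1 \<le> i \<Longrightarrow> i \<le> L \<Longrightarrow> 0 \<le> \<rho> i" "\<And>i. 1 \<le> i \<Longrightarrow> i \<le> L \<Longrightarrow> 0 \<le> a i" "i \<le> L"
  shows "0 \<le> entry_weight \<rho> a i"
  using assms(3)
proof (induction i)
  case (Suc i)
  then show ?case using assms(1)[of i] assms(2)[of "Suc i"] by (auto intro!: add_nonneg_nonneg)
qed simp

lemma state_weight_nonneg:
  assumes "\<And>i. 1 \<le> i \<Longrightarrow> i \<le> L \<Longrightarrow> 0 \<le> \<rho> i \<and> \<rho> i \<le> 1"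
    and "\<And>i j. 1 \<le> i \<Longrightarrow> i \<le> L \<Longrightarrow> 1 \<le> j \<Longrightarrow> 0 \<le> g i (x j)"
    and "1 \<le> i" "i \<le> L"
  shows "0 \<le> state_weight \<rho> g x n i"
  using assms(3,4)
proof (induction n arbitrary: i)
  case (Suc n)
  have "0 \<le> entry_weight \<rho> (state_weight \<rho> g x n) i"
    using assms(1) Suc by (intro entry_weight_nonneg[of L]) auto
  then show ?case using assms(1)[of i] assms(2)[of i "Suc n"] Suc.prems by simp
qed simp

text \<open>Mass balance: at each stage the fraction \<open>\<rho> i\<close> is passed on to the
  next stage and the rest stays, so the sum telescopes. What remains is the old mass, plus
  \<open>1\<close> from the source, minus what leaves the last stage.\<close>

lemma sum_entry_weight:
  assumes "1 \<le> L"
  shows "(\<Sum>i=1..L. entry_weight \<rho> a i * (1 - \<rho> i))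
           = 1 + (\<Sum>i=1..L. a i) - \<rho> L * entry_weight \<rho> a L"
  using assms
proof (induction L rule: nat_induct_at_least)
  case base
  show ?case by (simp add: algebra_simps)
next
  case (Suc L)
  then show ?case by (simp add: algebra_simps)
qed

lemma entry_weight_cong:
  "(\<And>j. j \<le> i \<Longrightarrow> a j = a' j) \<Longrightarrow> entry_weight \<rho> a i = entry_weight \<rho> a' i"
  by (induction i) auto

text \<open>Makes the weights functions of the past alone, so that independence of the next
  observation can be applied.\<close>

lemma state_weight_cong:
  assumes "\<And>k. 1 \<le> k \<Longrightarrow> k \<le> n \<Longrightarrow> x k = y k"
  shows "state_weight \<rho> g x n = state_weight \<rho> g y n"
  using assms by (induction n) auto

lemma entry_weight_measurable:
  assumes "\<And>j. 1 \<le> j \<Longrightarrow> j \<le> i \<Longrightarrow> (\<lambda>x. a x j) \<in> borel_measurable M"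
  shows "(\<lambda>x. entry_weight \<rho> (a x) i) \<in> borel_measurable M"
  using assms
proof (induction i)
  case (Suc i)
  have "(\<lambda>x. a x (Suc i)) \<in> borel_measurable M" "(\<lambda>x. entry_weight \<rho> (a x) i) \<in> borel_measurable M"
    using Suc by auto
  then show ?case by simp
qed simp

text \<open>The bound \<open>m\<close> is kept apart from \<open>n\<close> so that the weights of
  all times up to \<open>m\<close> are measurable on one product space.\<close>

lemma state_weight_measurable:
  assumes "\<And>i. 1 \<le> i \<Longrightarrow> i \<le> L \<Longrightarrow> g i \<in> borel_measurable \<mu>" and "n \<le> m" and "1 \<le> i" "i \<le> L"
  shows "(\<lambda>x. state_weight \<rho> g x n i) \<in> borel_measurable (Pi\<^sub>M {1..m} (\<lambda>_. \<mu>))"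
  using assms(2-)
proof (induction n arbitrary: i)
  case (Suc n)
  have [measurable]: "(\<lambda>x. entry_weight \<rho> (state_weight \<rho> g x n) i) \<in> borel_measurable (Pi\<^sub>M {1..m} (\<lambda>_. \<mu>))"
    using Suc by (intro entry_weight_measurable Suc.IH) auto
  have [measurable]: "(\<lambda>x. x (Suc n)) \<in> Pi\<^sub>M {1..m} (\<lambda>_. \<mu>) \<rightarrow>\<^sub>M \<mu>" "g i \<in> borel_measurable \<mu>"
    using Suc assms(1) by (auto intro!: measurable_component_singleton)
  show ?case unfolding state_weight.simps by measurable
qed simp

section \<open>Pathwise domination of the WD-CuSum statistic by the sum of the weights\<close>

lemma entry_weight_step:
  assumes rho: "\<And>i. 1 \<le> i \<Longrightarrow> i \<le> L \<Longrightarrow> 0 \<le> \<rho> i \<and> \<rho> i \<le> 1"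
    and g: "\<And>i j. 1 \<le> i \<Longrightarrow> i \<le> L \<Longrightarrow> 1 \<le> j \<Longrightarrow> 0 \<le> g i (x j)"
    and i: "1 \<le> i" "i \<le> L"
  shows "state_weight \<rho> g x n i \<le> entry_weight \<rho> (state_weight \<rho> g x n) i"
proof -
  obtain j where j: "i = Suc j" using i by (cases i) auto
  have "0 \<le> entry_weight \<rho> (state_weight \<rho> g x n) j"
    using rho i j by (intro entry_weight_nonneg[of L] state_weight_nonneg[where L=L] g) auto
  then show ?thesis using rho[of j] i j by auto
qed

text \<open>Contributions of other paths are nonnegative, so the total dominates the single path
  that carries \<open>q\<close> just before observation \<open>s + 1\<close> and then stays in stage
  \<open>i\<close> up to observation \<open>k\<close>.\<close>

lemma entry_weight_run:
  assumes rho: "\<And>i. 1 \<le> i \<Longrightarrow> i \<le> L \<Longrightarrow> 0 \<le> \<rho> i \<and> \<rho> i \<le> 1"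
    and g: "\<And>i j. 1 \<le> i \<Longrightarrow> i \<le> L \<Longrightarrow> 1 \<le> j \<Longrightarrow> 0 \<le> g i (x j)"
    and i: "1 \<le> i" "i \<le> L" and "s \<le> k"
    and q: "q \<le> entry_weight \<rho> (state_weight \<rho> g x s) i"
  shows "q * (\<Prod>j\<in>{Suc s..k}. (1 - \<rho> i) * g i (x j)) \<le> entry_weight \<rho> (state_weight \<rho> g x k) i"
  using \<open>s \<le> k\<close>
proof (induction k rule: dec_induct)
  case base
  then show ?case using q by simp
next
  case (step k)
  have "q * (\<Prod>j\<in>{Suc s..Suc k}. (1 - \<rho> i) * g i (x j))
      = q * (\<Prod>j\<in>{Suc s..k}. (1 - \<rho> i) * g i (x j)) * ((1 - \<rho> i) * g i (x (Suc k)))"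
    using step by (simp add: mult_ac)
  also have "\<dots> \<le> entry_weight \<rho> (state_weight \<rho> g x k) i * ((1 - \<rho> i) * g i (x (Suc k)))"
    using step rho[OF i] g[OF i, of "Suc k"] by (intro mult_right_mono) auto
  also have "\<dots> = state_weight \<rho> g x (Suc k) i" by simp
  also have "\<dots> \<le> entry_weight \<rho> (state_weight \<rho> g x (Suc k)) i"
    using entry_weight_step[where g=g and x=x and \<rho>=\<rho>, OF rho g i] .
  finally show ?case .
qed

text \<open>For a path that ends in stage \<open>i\<close>. The final statistic sums
  \<open>state_weight\<close>, whereas \<open>entry_weight\<close> already includes transitions made
  after the last observation; hence that observation is treated separately.\<close>

lemma state_weight_run:
  assumes rho: "\<And>i. 1 \<le> i \<Longrightarrow> i \<le> L \<Longrightarrow> 0 \<le> \<rho> i \<and> \<rho> i \<le> 1"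
    and g: "\<And>i j. 1 \<le> i \<Longrightarrow> i \<le> L \<Longrightarrow> 1 \<le> j \<Longrightarrow> 0 \<le> g i (x j)"
    and i: "1 \<le> i" "i \<le> L" and "s \<le> k"
    and q: "q \<le> entry_weight \<rho> (state_weight \<rho> g x s) i"
  shows "q * (\<Prod>j\<in>{Suc s..Suc k}. (1 - \<rho> i) * g i (x j)) \<le> state_weight \<rho> g x (Suc k) i"
proof -
  have "q * (\<Prod>j\<in>{Suc s..Suc k}. (1 - \<rho> i) * g i (x j))
      = q * (\<Prod>j\<in>{Suc s..k}. (1 - \<rho> i) * g i (x j)) * ((1 - \<rho> i) * g i (x (Suc k)))"
    using \<open>s \<le> k\<close> by (simp add: mult_ac)
  also have "\<dots> \<le> entry_weight \<rho> (state_weight \<rho> g x k) i * ((1 - \<rho> i) * g i (x (Suc k)))"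
    using entry_weight_run[where g=g and x=x and \<rho>=\<rho>, OF rho g i \<open>s \<le> k\<close> q] rho[OF i] g[OF i, of "Suc k"]
    by (intro mult_right_mono) auto
  finally show ?thesis by simp
qed

text \<open>If \<open>v 1 \<le> k\<close>, the path described by \<open>v\<close> is one of those
  whose weights are summed on the right. The path with \<open>v 1 = k + 1\<close> uses no
  observation and has ratio \<open>1\<close>, which is why the maximum appears.\<close>

lemma wd_ratio_le:
  fixes f :: "nat \<Rightarrow> 'a \<Rightarrow> real" and x :: "nat \<Rightarrow> 'a" and \<rho> :: "nat \<Rightarrow> real"
  defines "g \<equiv> \<lambda>i y. f i y / f 0 y"
  assumes L: "1 \<le> L"
    and rho: "\<And>i. 1 \<le> i \<Longrightarrow> i \<le> L \<Longrightarrow> 0 \<le> \<rho> i \<and> \<rho> i \<le> 1"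
    and f: "\<And>i j. i \<le> L \<Longrightarrow> 1 \<le> j \<Longrightarrow> 0 \<le> f i (x j)"
    and v: "v \<in> change_points L k"
  shows "(\<Prod>i=1..L. wd_factor L f \<rho> x k v i) / (\<Prod>j=v 1..k. f 0 (x j))
           \<le> max 1 (\<Sum>i=1..L. state_weight \<rho> g x k i)"
proof -
  \<comment> \<open>Setting \<open>v (L + 1) = k + 1\<close> instead of \<open>\<infinity>\<close> lets all stages be treated alike.\<close>
  define u where "u i = (if i \<le> L then v i else k + 1)" for i
  \<comment> \<open>The weight that the path has gathered when stage \<open>i\<close> begins,
    including the transition into that stage, relative to \<open>f 0\<close> on the observations
    \<open>v 1\<close> to \<open>u i - 1\<close>.\<close>
  define r where "r i = (\<Prod>l=1..<i. wd_factor L f \<rho> x k v l) / (\<Prod>j=v 1..<u i. f 0 (x j))" for i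
  let ?S = "\<Sum>i=1..L. state_weight \<rho> g x k i"
  have g: "0 \<le> g i (x j)" if "1 \<le> i" "i \<le> L" "1 \<le> j" for i j
    using f[of i j] f[of 0 j] that by (simp add: g_def)
  have v_range: "1 \<le> v i" "v i \<le> k + 1" if "1 \<le> i" "i \<le> L" for i
    using v that by (auto simp: change_points_def PiE_iff)
  have u_range: "1 \<le> u i" "u i \<le> k + 1" if "1 \<le> i" for i
    using v_range[of i] that by (auto simp: u_def)
  have u_mono: "u i \<le> u (Suc i)" if "1 \<le> i" for i
    using v v_range[of i] that by (auto simp: u_def change_points_def)
  have u1_le: "u 1 \<le> u i" if "1 \<le> i" for i
    using that proof (induction i rule: nat_induct_at_least)
    case (Suc i)
    then show ?case using u_mono[of i] by simp
  qed simp
  have u1: "u 1 = v 1" using L by (simp add: u_def)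
  have factor: "wd_factor L f \<rho> x k v i = (\<Prod>j=u i..<u (Suc i). f i (x j) * (1 - \<rho> i))
      * (if i < L \<and> u (Suc i) \<le> k then \<rho> i else 1)" if i: "1 \<le> i" "i \<le> L" for i
  proof -
    have "{j. v i \<le> j \<and> enat j < next_change L v i \<and> j \<le> k} = {u i..<u (Suc i)}"
      using i v_range[of "Suc i"] by (auto simp: u_def next_change_def)
    moreover have "next_change L v i \<le> enat k \<longleftrightarrow> i < L \<and> u (Suc i) \<le> k"
      by (auto simp: u_def next_change_def)
    ultimately show ?thesis by (simp add: wd_factor_def)
  qed
  \<comment> \<open>Real division by zero is \<open>0\<close>, so quotients of products split even
    where \<open>f 0\<close> vanishes at an observation.\<close>
  have r_Suc: "r (Suc i) = r i * (\<Prod>j=u i..<u (Suc i). (1 - \<rho> i) * g i (x j))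
      * (if i < L \<and> u (Suc i) \<le> k then \<rho> i else 1)" if i: "1 \<le> i" "i \<le> L" for i
  proof -
    have "(\<Prod>j=v 1..<u (Suc i). f 0 (x j)) = (\<Prod>j=v 1..<u i. f 0 (x j)) * (\<Prod>j=u i..<u (Suc i). f 0 (x j))"
      using u1_le[of i] u1 u_mono[of i] i by (simp add: prod.atLeastLessThan_concat)
    then show ?thesis using i
      by (simp add: r_def factor g_def prod_dividef prod.distrib mult_ac)
  qed
  \<comment> \<open>Invariant along the path: either observations remain, and the path is part of
    the weight entering stage \<open>i\<close> after the first \<open>u i - 1\<close> observations,
    or all observations are used up and the final bound already holds.\<close>
  have claim: "(u i \<le> k \<and> i \<le> L \<and> r i \<le> entry_weight \<rho> (state_weight \<rho> g x (u i - 1)) i)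
      \<or> (u i = k + 1 \<and> r i \<le> max 1 ?S)" if "1 \<le> i" "i \<le> Suc L" for i
    using that
  proof (induction i rule: nat_induct_at_least)
    case base
    have "r 1 = 1" using u1 by (simp add: r_def)
    then show ?case
      using u_range[of 1] L state_weight_nonneg[where L=L and g=g and x=x and \<rho>=\<rho>, OF rho g, of 1] by auto
  next
    case (Suc i)
    then have i: "1 \<le> i" "i \<le> L" by auto
    note ui = u_range(1)[OF i(1)] u_mono[OF i(1)] u_range(2)[of "Suc i"]
    from Suc.IH i consider
        "u i \<le> k" "r i \<le> entry_weight \<rho> (state_weight \<rho> g x (u i - 1)) i"
      | "u i = k + 1" "r i \<le> max 1 ?S" by auto
    then show ?case
    proof cases
      case 2
      \<comment> \<open>From here on the stages are empty and carry no transition factor, so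
        \<open>r\<close> stays constant.\<close>
      then have "u (Suc i) = k + 1" using ui by auto
      then show ?thesis using 2 r_Suc[OF i] by simp
    next
      case 1
      let ?p = "\<Prod>j=u i..<u (Suc i). (1 - \<rho> i) * g i (x j)"
      show ?thesis
      proof (cases "u (Suc i) \<le> k")
        case True
        then have "i < L" using i by (auto simp: u_def split: if_splits)
        have "{u i..<u (Suc i)} = {Suc (u i - 1)..u (Suc i) - 1}" using ui by auto
        then have "r i * ?p \<le> entry_weight \<rho> (state_weight \<rho> g x (u (Suc i) - 1)) i"
          using entry_weight_run[where g=g and x=x and \<rho>=\<rho>, OF rho g i _ 1(2), of "u (Suc i) - 1"] ui by simp
        then have "r (Suc i) \<le> entry_weight \<rho> (state_weight \<rho> g x (u (Suc i) - 1)) i * \<rho> i"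
          using r_Suc[OF i] \<open>i < L\<close> True rho[OF i] by (simp add: mult_right_mono)
        also have "\<dots> \<le> entry_weight \<rho> (state_weight \<rho> g x (u (Suc i) - 1)) (Suc i)"
          using state_weight_nonneg[where L=L and g=g and x=x and \<rho>=\<rho>, OF rho g, of "Suc i"] \<open>i < L\<close> i by (simp add: mult.commute)
        finally show ?thesis using True \<open>i < L\<close> by simp
      next
        case False
        \<comment> \<open>The path ends in stage \<open>i\<close>: no transition factor is due, and
          its weight is bounded by one summand of \<open>?S\<close>.\<close>
        then have eq: "u (Suc i) = k + 1" using ui by auto
        have "{u i..<u (Suc i)} = {Suc (u i - 1)..Suc (k - 1)}" using ui eq 1 by auto
        moreover have "Suc (k - 1) = k" using ui 1 by auto
        ultimately have "r i * ?p \<le> state_weight \<rho> g x k i"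
          using state_weight_run[where g=g and x=x and \<rho>=\<rho>, OF rho g i _ 1(2), of "k - 1"] 1 ui by simp
        also have "\<dots> \<le> ?S"
          using i by (intro member_le_sum state_weight_nonneg[where L=L] rho g) auto
        finally show ?thesis using r_Suc[OF i] eq by simp
      qed
    qed
  qed
  have "{1..<Suc L} = {1..L}" "{v 1..<k + 1} = {v 1..k}" by auto
  then have "r (Suc L) = (\<Prod>i=1..L. wd_factor L f \<rho> x k v i) / (\<Prod>j=v 1..k. f 0 (x j))"
    by (simp add: r_def u_def)
  then show ?thesis using claim[of "Suc L"] by auto
qed

lemma exp_le_sum_state_weight:
  fixes f :: "nat \<Rightarrow> 'a \<Rightarrow> real" and x :: "nat \<Rightarrow> 'a" and \<rho> :: "nat \<Rightarrow> real"
  assumes L: "1 \<le> L"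
    and rho: "\<And>i. 1 \<le> i \<Longrightarrow> i \<le> L \<Longrightarrow> 0 \<le> \<rho> i \<and> \<rho> i \<le> 1"
    and f: "\<And>i j. i \<le> L \<Longrightarrow> 1 \<le> j \<Longrightarrow> 0 \<le> f i (x j)"
    and b: "0 < b" "ereal b \<le> wd_cusum_plus L f \<rho> x k"
  shows "exp b \<le> (\<Sum>i=1..L. state_weight \<rho> (\<lambda>i y. f i y / f 0 y) x k i)"
proof -
  let ?h = "\<lambda>v. (\<Prod>i=1..L. wd_factor L f \<rho> x k v i) / (\<Prod>j=v 1..k. f 0 (x j))"
  have "change_points L k \<subseteq> {1..L} \<rightarrow>\<^sub>E {1..k + 1}" by (auto simp: change_points_def)
  then have "finite (change_points L k)" by (rule finite_subset) (auto intro: finite_PiE)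
  \<comment> \<open>This constant path makes the index set nonempty, so the maximum is
    attained.\<close>
  moreover have "(\<lambda>i\<in>{1..L}. 1) \<in> change_points L k" by (auto simp: change_points_def)
  ultimately have "wd_cusum_plus L f \<rho> x k \<in> (\<lambda>v. ext_ln (?h v)) ` change_points L k"
    unfolding wd_cusum_plus_def by (intro Max_in) auto
  then obtain v where v: "v \<in> change_points L k" "ereal b \<le> ext_ln (?h v)" using b by auto
  then have "0 < ?h v" "b \<le> ln (?h v)" by (auto simp: ext_ln_def split: if_splits)
  then have "exp b \<le> ?h v" by (simp add: ln_ge_iff)
  also have "\<dots> \<le> max 1 (\<Sum>i=1..L. state_weight \<rho> (\<lambda>i y. f i y / f 0 y) x k i)"
    using wd_ratio_le[where f=f and x=x and \<rho>=\<rho>, OF L rho f v(1)] .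
  \<comment> \<open>As \<open>b > 0\<close>, \<open>exp b\<close> exceeds \<open>1\<close>, which
    rules out the value \<open>1\<close> of the maximum.\<close>
  finally show ?thesis using b(1) by (auto simp: max_def not_le split: if_splits)
qed


section \<open>Supermartingale property and optional stopping under the no-change measure\<close>

text \<open>By independence the expectation of the product factors, and the second factor is at most
  \<open>1\<close>. This is the one-step estimate behind the supermartingale property.\<close>

lemma (in prob_space) nn_integral_past_times_next_le:
  fixes H :: "(nat \<Rightarrow> 'b) \<Rightarrow> ennreal" and h :: "'b \<Rightarrow> ennreal"
  assumes indep: "indep_vars (\<lambda>_. N) X {1..}"
    and [measurable]: "H \<in> borel_measurable (Pi\<^sub>M {1..n} (\<lambda>_. N))" "h \<in> borel_measurable N"
    and h: "(\<integral>\<^sup>+\<omega>. h (X (Suc n) \<omega>) \<partial>M) \<le> 1"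
  shows "(\<integral>\<^sup>+\<omega>. H (\<lambda>k\<in>{1..n}. X k \<omega>) * h (X (Suc n) \<omega>) \<partial>M)
           \<le> (\<integral>\<^sup>+\<omega>. H (\<lambda>k\<in>{1..n}. X k \<omega>) \<partial>M)"
proof -
  let ?Y = "\<lambda>\<omega>. H (\<lambda>k\<in>{1..n}. X k \<omega>)" and ?Z = "\<lambda>\<omega>. h (X (Suc n) \<omega>)"
  have "indep_var borel (H \<circ> (\<lambda>\<omega>. \<lambda>k\<in>{1..n}. X k \<omega>))
      borel ((\<lambda>x. h (x (Suc n))) \<circ> (\<lambda>\<omega>. \<lambda>k\<in>{Suc n}. X k \<omega>))"
    by (intro indep_var_compose[OF indep_var_restrict[OF indep]] assms(2)) auto
  then have "indep_vars (case_bool borel borel) (case_bool ?Y ?Z) UNIV"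
    by (simp add: indep_var_def comp_def)
  \<comment> \<open>\<open>indep_var\<close> is independence of a family indexed by the booleans;
    the product rule for such families wants one common target space.\<close>
  moreover have "case_bool borel borel = (\<lambda>_. borel :: ennreal measure)" by (auto split: bool.split)
  ultimately have "(\<integral>\<^sup>+\<omega>. (\<Prod>c\<in>UNIV. (case c of True \<Rightarrow> ?Y | False \<Rightarrow> ?Z) \<omega>) \<partial>M)
      = (\<Prod>c\<in>UNIV. \<integral>\<^sup>+\<omega>. (case c of True \<Rightarrow> ?Y | False \<Rightarrow> ?Z) \<omega> \<partial>M)"
    by (intro indep_vars_nn_integral) (simp_all del: One_nat_def)
  then have "(\<integral>\<^sup>+\<omega>. ?Y \<omega> * ?Z \<omega> \<partial>M) = (\<integral>\<^sup>+\<omega>. ?Y \<omega> \<partial>M) * (\<integral>\<^sup>+\<omega>. ?Z \<omega> \<partial>M)"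
    by (simp add: UNIV_bool mult.commute)
  also have "\<dots> \<le> (\<integral>\<^sup>+\<omega>. ?Y \<omega> \<partial>M)" using mult_left_mono[OF h, of "\<integral>\<^sup>+\<omega>. ?Y \<omega> \<partial>M"] by simp
  finally show ?thesis .
qed

theorem theorem1:
  fixes \<mu> :: "'a measure" and P :: "'w measure"
    and f :: "nat \<Rightarrow> 'a \<Rightarrow> real" and X :: "nat \<Rightarrow> 'w \<Rightarrow> 'a"
    and \<rho> :: "nat \<Rightarrow> real" and L :: nat and b :: real
  assumes "L \<ge> 1"
    and "\<And>i. i \<le> L \<Longrightarrow> prob_density \<mu> (f i)"
    and "\<And>i. 1 \<le> i \<Longrightarrow> i \<le> L \<Longrightarrow> 0 < KL_div \<mu> (f i) (f 0) \<and> KL_div \<mu> (f i) (f 0) < \<infinity>"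
    and "prob_space P"
    and "prob_space.indep_vars P (\<lambda>_. \<mu>) X {1..}"
    and "\<And>k. 1 \<le> k \<Longrightarrow> distributed P \<mu> (X k) (\<lambda>x. ennreal (f 0 x))"
    and "\<And>i. 1 \<le> i \<Longrightarrow> i \<le> L - 1 \<Longrightarrow> 0 < \<rho> i \<and> \<rho> i < 1"
    and "\<rho> L = 0"
    and "b > 0"
  shows "(\<integral>\<^sup>+ \<omega>. ennreal_of_enat (wd_cusum_time L f \<rho> (\<lambda>k. X k \<omega>) b) \<partial>P) \<ge> ennreal (1 / 2 * exp b)"
proof -
  interpret prob_space P by fact
  define g where "g i y = f i y / f 0 y" for i y
  define S where "S x n = (\<Sum>i=1..L. state_weight \<rho> g x n i)" for x n
  \<comment> \<open>The event \<open>G n\<close> seen in the space of the first \<open>n\<close>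
    observations; it lets the indicator of \<open>G n\<close> be written as a measurable function of
    the past.\<close>
  define A where "A n = {x \<in> space (Pi\<^sub>M {1..n} (\<lambda>_. \<mu>)). \<forall>k\<le>n. S x k < exp b}" for n
  define R where "R n \<omega> = S (\<lambda>k. X k \<omega>) n" for n \<omega>
  define G where "G n = {\<omega> \<in> space P. \<forall>k\<le>n. R k \<omega> < exp b}" for n
  have rho: "0 \<le> \<rho> i \<and> \<rho> i \<le> 1" if "1 \<le> i" "i \<le> L" for i
    using assms(7)[of i] assms(8) that by (cases "i = L") force+
  have f_meas [measurable]: "f i \<in> borel_measurable \<mu>" if "i \<le> L" for i
    using assms(2)[OF that] by (simp add: prob_density_def)
  have f_nonneg: "0 \<le> f i y" if "i \<le> L" "y \<in> space \<mu>" for i y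
    using assms(2)[OF that(1)] that(2) by (simp add: prob_density_def)
  have X_meas [measurable]: "X k \<in> P \<rightarrow>\<^sub>M \<mu>" if "1 \<le> k" for k
    using assms(6)[OF that] by (simp add: distributed_def)
  have X_space: "X k \<omega> \<in> space \<mu>" if "1 \<le> k" "\<omega> \<in> space P" for k \<omega>
    using measurable_space[OF X_meas[OF that(1)] that(2)] .
  have g_meas [measurable]: "g i \<in> borel_measurable \<mu>" if "1 \<le> i" "i \<le> L" for i
    using f_meas[of i] f_meas[of 0] that unfolding g_def by measurable
  have g_nonneg: "0 \<le> g i (X j \<omega>)" if "1 \<le> i" "i \<le> L" "1 \<le> j" "\<omega> \<in> space P" for i j \<omega>
    using f_nonneg[of i] f_nonneg[of 0] X_space that by (simp add: g_def)
  \<comment> \<open>The integrand \<open>f 0 * g i\<close> equals \<open>f i\<close> where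
    \<open>f 0\<close> is positive and \<open>0\<close> elsewhere, hence the inequality.\<close>
  have g_int: "(\<integral>\<^sup>+\<omega>. ennreal (g i (X k \<omega>)) \<partial>P) \<le> 1" if i: "1 \<le> i" "i \<le> L" and k: "1 \<le> k" for i k
  proof -
    have [measurable]: "g i \<in> borel_measurable \<mu>" using g_meas i .
    have "(\<integral>\<^sup>+\<omega>. ennreal (g i (X k \<omega>)) \<partial>P) = (\<integral>\<^sup>+y. ennreal (f 0 y) * ennreal (g i y) \<partial>\<mu>)"
      by (rule distributed_nn_integral[OF assms(6)[OF k], symmetric]) measurable
    also have "\<dots> \<le> (\<integral>\<^sup>+y. ennreal (f i y) \<partial>\<mu>)"
      using f_nonneg i
      by (intro nn_integral_mono) (auto simp: g_def ennreal_mult[symmetric] intro!: ennreal_leI)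
    also have "\<dots> = 1" using assms(2)[OF i(2)] by (simp add: prob_density_def)
    finally show ?thesis .
  qed
  have S_meas: "(\<lambda>x. S x n) \<in> borel_measurable (Pi\<^sub>M {1..m} (\<lambda>_. \<mu>))" if "n \<le> m" for n m
    unfolding S_def using that by (intro borel_measurable_sum state_weight_measurable[where L=L] g_meas) auto
  have A_meas [measurable]: "A n \<in> sets (Pi\<^sub>M {1..n} (\<lambda>_. \<mu>))" for n
  proof -
    have "A n = (\<Inter>k\<in>{..n}. {x \<in> space (Pi\<^sub>M {1..n} (\<lambda>_. \<mu>)). S x k < exp b})"
      by (auto simp: A_def)
    also have "\<dots> \<in> sets (Pi\<^sub>M {1..n} (\<lambda>_. \<mu>))"
    proof (intro sets.finite_INT)
      fix k assume "k \<in> {..n}"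
      then have [measurable]: "(\<lambda>x. S x k) \<in> borel_measurable (Pi\<^sub>M {1..n} (\<lambda>_. \<mu>))"
        by (intro S_meas) simp
      show "{x \<in> space (Pi\<^sub>M {1..n} (\<lambda>_. \<mu>)). S x k < exp b} \<in> sets (Pi\<^sub>M {1..n} (\<lambda>_. \<mu>))"
        by measurable
    qed auto
    finally show ?thesis .
  qed
  have past_meas: "(\<lambda>\<omega>. \<lambda>k\<in>{1..n}. X k \<omega>) \<in> P \<rightarrow>\<^sub>M Pi\<^sub>M {1..n} (\<lambda>_. \<mu>)" for n
    by (intro measurable_restrict X_meas) simp
  \<comment> \<open>Restriction makes the observations after \<open>n\<close> undefined, but the
    weights up to time \<open>n\<close> do not read them.\<close>
  have weight_past: "state_weight \<rho> g (\<lambda>k\<in>{1..n}. X k \<omega>) k = state_weight \<rho> g (\<lambda>k. X k \<omega>) k"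
    if "k \<le> n" for k n \<omega>
    using that by (intro state_weight_cong) simp
  have S_past: "S (\<lambda>k\<in>{1..n}. X k \<omega>) k = R k \<omega>" if "k \<le> n" for k n \<omega>
    using weight_past[OF that] by (simp add: S_def R_def)
  have A_past: "(\<lambda>k\<in>{1..n}. X k \<omega>) \<in> A n \<longleftrightarrow> \<omega> \<in> G n" if "\<omega> \<in> space P" for n \<omega>
    using measurable_space[OF past_meas that] S_past that by (auto simp: A_def G_def)
  have R_meas [measurable]: "R n \<in> borel_measurable P" for n
    using measurable_compose[OF past_meas S_meas[OF order_refl[of n]]] S_past[of n n] by simp
  have G_meas [measurable]: "G n \<in> sets P" for n
    unfolding G_def by measurable
  have state_nonneg: "0 \<le> state_weight \<rho> g (\<lambda>k. X k \<omega>) n i" if "1 \<le> i" "i \<le> L" "\<omega> \<in> space P" for n i \<omega>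
    using that by (intro state_weight_nonneg[where L=L] rho g_nonneg) auto
  have entry_nonneg: "0 \<le> entry_weight \<rho> (state_weight \<rho> g (\<lambda>k. X k \<omega>) n) i" if "i \<le> L" "\<omega> \<in> space P" for n i \<omega>
    using that rho state_nonneg by (intro entry_weight_nonneg[of L]) auto
  have R_nonneg: "0 \<le> R n \<omega>" if "\<omega> \<in> space P" for n \<omega>
    using that state_nonneg by (auto simp: R_def S_def intro!: sum_nonneg)

  \<comment> \<open>The supermartingale property of \<open>R n - n\<close>, restricted to the past
    event \<open>G n\<close>.\<close>
  have drift: "(\<integral>\<^sup>+\<omega>. ennreal (R (Suc n) \<omega>) * indicator (G n) \<omega> \<partial>P)
      \<le> emeasure P (G n) + (\<integral>\<^sup>+\<omega>. ennreal (R n \<omega>) * indicator (G n) \<omega> \<partial>P)" for n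
  proof -
    \<comment> \<open>The part of the next weight of stage \<open>i\<close> that is known at time
      \<open>n\<close>; only the likelihood ratio of the new observation is split off.\<close>
    define H where "H i x = ennreal (entry_weight \<rho> (state_weight \<rho> g x n) i * (1 - \<rho> i)) * indicator (A n) x" for i x
    have H_meas: "H i \<in> borel_measurable (Pi\<^sub>M {1..n} (\<lambda>_. \<mu>))" if "1 \<le> i" "i \<le> L" for i
    proof -
      have [measurable]: "(\<lambda>x. entry_weight \<rho> (state_weight \<rho> g x n) i) \<in> borel_measurable (Pi\<^sub>M {1..n} (\<lambda>_. \<mu>))"
        using that by (intro entry_weight_measurable state_weight_measurable[where L=L] g_meas) auto
      show ?thesis unfolding H_def by measurable
    qed
    note H_past_meas = measurable_compose[OF past_meas H_meas]
    have H_past: "H i (\<lambda>k\<in>{1..n}. X k \<omega>) = ennreal (entry_weight \<rho> (state_weight \<rho> g (\<lambda>k. X k \<omega>) n) i * (1 - \<rho> i)) * indicator (G n) \<omega>"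
      if "\<omega> \<in> space P" for i \<omega>
      using A_past[OF that, of n] weight_past[OF order_refl] by (simp add: H_def indicator_def)
    have "ennreal (R (Suc n) \<omega>) * indicator (G n) \<omega>
        = (\<Sum>i=1..L. H i (\<lambda>k\<in>{1..n}. X k \<omega>) * ennreal (g i (X (Suc n) \<omega>)))" if \<omega>: "\<omega> \<in> space P" for \<omega>
    proof -
      have "ennreal (R (Suc n) \<omega>) = (\<Sum>i=1..L. ennreal (state_weight \<rho> g (\<lambda>k. X k \<omega>) (Suc n) i))"
        unfolding R_def S_def by (intro sum_ennreal[symmetric] state_nonneg \<omega>) auto
      also have "\<dots> = (\<Sum>i=1..L. ennreal (entry_weight \<rho> (state_weight \<rho> g (\<lambda>k. X k \<omega>) n) i * (1 - \<rho> i))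
          * ennreal (g i (X (Suc n) \<omega>)))"
        using entry_nonneg rho g_nonneg \<omega>
        by (intro sum.cong refl) (auto simp: ennreal_mult[symmetric] mult_ac)
      finally show ?thesis
        by (cases "\<omega> \<in> G n") (simp_all add: H_past[OF \<omega>] del: One_nat_def)
    qed
    then have "(\<integral>\<^sup>+\<omega>. ennreal (R (Suc n) \<omega>) * indicator (G n) \<omega> \<partial>P)
        = (\<integral>\<^sup>+\<omega>. (\<Sum>i=1..L. H i (\<lambda>k\<in>{1..n}. X k \<omega>) * ennreal (g i (X (Suc n) \<omega>))) \<partial>P)"
      by (intro nn_integral_cong) auto
    also have "\<dots> = (\<Sum>i=1..L. \<integral>\<^sup>+\<omega>. H i (\<lambda>k\<in>{1..n}. X k \<omega>) * ennreal (g i (X (Suc n) \<omega>)) \<partial>P)"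
      using H_past_meas by (intro nn_integral_sum borel_measurable_times) auto
    also have "\<dots> \<le> (\<Sum>i=1..L. \<integral>\<^sup>+\<omega>. H i (\<lambda>k\<in>{1..n}. X k \<omega>) \<partial>P)"
      using H_meas g_int by (intro sum_mono nn_integral_past_times_next_le[OF assms(5)]) auto
    also have "\<dots> = (\<integral>\<^sup>+\<omega>. (\<Sum>i=1..L. H i (\<lambda>k\<in>{1..n}. X k \<omega>)) \<partial>P)"
      using H_past_meas by (intro nn_integral_sum[symmetric]) auto
    also have "\<dots> = (\<integral>\<^sup>+\<omega>. indicator (G n) \<omega> + ennreal (R n \<omega>) * indicator (G n) \<omega> \<partial>P)"
    proof (intro nn_integral_cong)
      fix \<omega> assume \<omega>: "\<omega> \<in> space P"
      have "(\<Sum>i=1..L. ennreal (entry_weight \<rho> (state_weight \<rho> g (\<lambda>k. X k \<omega>) n) i * (1 - \<rho> i)))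
          = ennreal (\<Sum>i=1..L. entry_weight \<rho> (state_weight \<rho> g (\<lambda>k. X k \<omega>) n) i * (1 - \<rho> i))"
        using entry_nonneg rho \<omega> by (intro sum_ennreal) auto
      \<comment> \<open>Since \<open>\<rho> L = 0\<close>, nothing leaves the last stage, so the
        mass grows by exactly the \<open>1\<close> from the source.\<close>
      also have "\<dots> = 1 + ennreal (R n \<omega>)"
        using R_nonneg[OF \<omega>, of n] unfolding sum_entry_weight[OF assms(1)]
        by (simp add: assms(8) R_def S_def)
      finally show "(\<Sum>i=1..L. H i (\<lambda>k\<in>{1..n}. X k \<omega>)) = indicator (G n) \<omega> + ennreal (R n \<omega>) * indicator (G n) \<omega>"
        by (cases "\<omega> \<in> G n") (simp_all add: H_past[OF \<omega>] del: One_nat_def)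
    qed
    also have "\<dots> = emeasure P (G n) + (\<integral>\<^sup>+\<omega>. ennreal (R n \<omega>) * indicator (G n) \<omega> \<partial>P)"
      by (subst nn_integral_add) auto
    finally show ?thesis .
  qed

  have G_Suc: "G (Suc n) \<subseteq> G n" for n by (auto simp: G_def)
  \<comment> \<open>Optional stopping by induction: once \<open>R\<close> has reached
    \<open>exp b\<close> it is frozen and counted only as \<open>exp b\<close>, while the drift of
    one per step accrues only on the events \<open>G j\<close>.\<close>
  have stopped: "ennreal (exp b) * emeasure P (space P - G n) + (\<integral>\<^sup>+\<omega>. ennreal (R n \<omega>) * indicator (G n) \<omega> \<partial>P)
      \<le> (\<Sum>j<n. emeasure P (G j))" for n
  proof (induction n)
    case 0
    have "R 0 \<omega> = 0" for \<omega> by (simp add: R_def S_def)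
    then show ?case by (simp add: G_def)
  next
    case (Suc n)
    have "ennreal (exp b) * emeasure P (G n - G (Suc n)) + (\<integral>\<^sup>+\<omega>. ennreal (R (Suc n) \<omega>) * indicator (G (Suc n)) \<omega> \<partial>P)
        = (\<integral>\<^sup>+\<omega>. ennreal (exp b) * indicator (G n - G (Suc n)) \<omega> + ennreal (R (Suc n) \<omega>) * indicator (G (Suc n)) \<omega> \<partial>P)"
      by (subst nn_integral_add) (auto simp: nn_integral_cmult_indicator)
    also have "\<dots> \<le> (\<integral>\<^sup>+\<omega>. ennreal (R (Suc n) \<omega>) * indicator (G n) \<omega> \<partial>P)"
    proof (intro nn_integral_mono)
      fix \<omega> assume "\<omega> \<in> space P"
      \<comment> \<open>Leaving \<open>G n\<close> at the next time can only be due to the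
        constraint at \<open>Suc n\<close>.\<close>
      then have "exp b \<le> R (Suc n) \<omega>" if "\<omega> \<in> G n - G (Suc n)"
        using that by (auto simp: G_def le_Suc_eq not_less)
      then show "ennreal (exp b) * indicator (G n - G (Suc n)) \<omega> + ennreal (R (Suc n) \<omega>) * indicator (G (Suc n)) \<omega>
          \<le> ennreal (R (Suc n) \<omega>) * indicator (G n) \<omega>"
        using G_Suc[of n] by (auto simp: indicator_def intro!: ennreal_leI)
    qed
    also note drift[of n]
    finally have *: "ennreal (exp b) * emeasure P (G n - G (Suc n)) + (\<integral>\<^sup>+\<omega>. ennreal (R (Suc n) \<omega>) * indicator (G (Suc n)) \<omega> \<partial>P)
        \<le> emeasure P (G n) + (\<integral>\<^sup>+\<omega>. ennreal (R n \<omega>) * indicator (G n) \<omega> \<partial>P)" .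
    have "space P - G (Suc n) = (space P - G n) \<union> (G n - G (Suc n))"
      using G_Suc[of n] by (auto simp: G_def)
    then have "emeasure P (space P - G (Suc n)) = emeasure P (space P - G n) + emeasure P (G n - G (Suc n))"
      by (simp, subst plus_emeasure[symmetric]) auto
    then have "ennreal (exp b) * emeasure P (space P - G (Suc n)) + (\<integral>\<^sup>+\<omega>. ennreal (R (Suc n) \<omega>) * indicator (G (Suc n)) \<omega> \<partial>P)
        = ennreal (exp b) * emeasure P (space P - G n) + (ennreal (exp b) * emeasure P (G n - G (Suc n))
          + (\<integral>\<^sup>+\<omega>. ennreal (R (Suc n) \<omega>) * indicator (G (Suc n)) \<omega> \<partial>P))"
      by (simp add: distrib_left add.assoc)
    also have "\<dots> \<le> ennreal (exp b) * emeasure P (space P - G n)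
        + (emeasure P (G n) + (\<integral>\<^sup>+\<omega>. ennreal (R n \<omega>) * indicator (G n) \<omega> \<partial>P))"
      by (intro add_left_mono *)
    also have "\<dots> \<le> (\<Sum>j<n. emeasure P (G j)) + emeasure P (G n)"
      using add_right_mono[OF Suc.IH, of "emeasure P (G n)"] by (simp add: add_ac)
    finally show ?case by simp
  qed

  \<comment> \<open>Transfer to the WD-CuSum stopping time and choice of the horizon\<close>
  let ?\<tau> = "\<lambda>\<omega>. wd_cusum_time L f \<rho> (\<lambda>k. X k \<omega>) b"
  let ?T = "\<integral>\<^sup>+ \<omega>. ennreal_of_enat (?\<tau> \<omega>) \<partial>P"
  \<comment> \<open>An alarm at time \<open>k\<close> forces \<open>R k\<close> to be at least
    \<open>exp b\<close>, so there is no alarm while \<open>R\<close> stays below that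
    level.\<close>
  have time_gt: "enat j < ?\<tau> \<omega>" if \<omega>: "\<omega> \<in> G j" for j \<omega>
  proof -
    have sp: "\<omega> \<in> space P" using \<omega> by (simp add: G_def)
    have "enat (Suc j) \<le> ?\<tau> \<omega>"
      unfolding wd_cusum_time_def
    proof (rule Inf_greatest, clarify)
      fix k assume k: "1 \<le> k" "ereal b \<le> wd_cusum_plus L f \<rho> (\<lambda>k. X k \<omega>) k"
      have "exp b \<le> R k \<omega>"
        unfolding R_def S_def g_def using assms(1) rho assms(9) k(2) f_nonneg X_space sp
        by (intro exp_le_sum_state_weight) auto
      then have "\<not> k \<le> j" using \<omega> by (auto simp: G_def not_less)
      then show "enat (Suc j) \<le> enat k" by simp
    qed
    then show ?thesis by (simp add: Suc_ile_eq)
  qed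
  \<comment> \<open>Each \<open>G j\<close> puts the stopping time above \<open>j\<close>, so the
    number of indices \<open>j\<close> with \<open>G j\<close> is at most its value.\<close>
  have sum_le: "(\<Sum>j<n. emeasure P (G j)) \<le> ?T" for n
  proof -
    have "(\<Sum>j<n. emeasure P (G j)) = (\<integral>\<^sup>+\<omega>. (\<Sum>j<n. indicator (G j) \<omega>) \<partial>P)"
      by (subst nn_integral_sum) auto
    also have "\<dots> \<le> ?T"
    proof (intro nn_integral_mono)
      fix \<omega>
      have "(\<Sum>j<n. indicator (G j) \<omega> :: ennreal) = of_nat (card {j. j < n \<and> \<omega> \<in> G j})"
        by (simp add: indicator_def sum.If_cases Int_def)
      also have "\<dots> \<le> ennreal_of_enat (?\<tau> \<omega>)"
      proof (cases "?\<tau> \<omega>")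
        case (enat m)
        then have "{j. j < n \<and> \<omega> \<in> G j} \<subseteq> {..<m}" using time_gt[of \<omega>] by auto
        then have "card {j. j < n \<and> \<omega> \<in> G j} \<le> m" using card_mono[of "{..<m}"] by simp
        then show ?thesis using enat by simp
      qed simp
      finally show "(\<Sum>j<n. indicator (G j) \<omega> :: ennreal) \<le> ennreal_of_enat (?\<tau> \<omega>)" .
    qed
    finally show ?thesis .
  qed
  show ?thesis
  proof (cases ?T)
    case top
    then show ?thesis by simp
  next
    case (real t)
    \<comment> \<open>The bound \<open>2 * t\<close> yields the constant \<open>1 / 2\<close>; the
      successor keeps \<open>n\<close> positive even for \<open>t = 0\<close>, so that
      \<open>n\<close> can be cancelled.\<close>
    define n where "n = Suc (nat \<lceil>2 * t\<rceil>)"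
    have n: "2 * t \<le> real n" "0 < n" unfolding n_def by linarith+
    have "of_nat n * emeasure P (G n) = (\<Sum>j<n. emeasure P (G n))" by simp
    \<comment> \<open>The events decrease, so \<open>G n\<close> is the least likely of
      them.\<close>
    also have "\<dots> \<le> (\<Sum>j<n. emeasure P (G j))"
      by (intro sum_mono emeasure_mono G_meas) (auto simp: G_def)
    also have "\<dots> \<le> ennreal t" using sum_le real by simp
    finally have "ennreal (real n * prob (G n)) \<le> ennreal t"
      by (simp add: emeasure_eq_measure ennreal_mult ennreal_of_nat_eq_real_of_nat)
    then have "real n * prob (G n) \<le> t" using real by (simp add: ennreal_le_iff)
    also have "t \<le> real n * (1 / 2)" using n by simp
    finally have half: "prob (G n) \<le> 1 / 2" using n by (simp only: mult_le_cancel_left_pos of_nat_0_less_iff)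
    \<comment> \<open>The integral of \<open>R n\<close> over \<open>G n\<close> in
      \<open>stopped\<close> is nonnegative and is dropped.\<close>
    have "ennreal (exp b) * emeasure P (space P - G n) \<le> ennreal t"
      using order_trans[OF order_trans[OF _ stopped[of n]] sum_le[of n]] real by simp
    then have "exp b * prob (space P - G n) \<le> t"
      using real by (simp add: emeasure_eq_measure ennreal_mult[symmetric] ennreal_le_iff)
    moreover have "exp b * (1 / 2) \<le> exp b * prob (space P - G n)"
      using half by (intro mult_left_mono) (auto simp: prob_compl)
    ultimately have "1 / 2 * exp b \<le> t" by linarith
    then show ?thesis using real by (simp add: ennreal_leI)
  qed
qed

end
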